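(* Let $M\ge1$, $B_c>0$, and for $m=1,\dots,M$ let $W_{1,m},W_{2,m}>0$ and $\Gamma_{1,m}\ge\Gamma_{2,m}>0$ satisfy $1<W_{2,m}/W_{1,m}<\Gamma_{1,m}/\Gamma_{2,m}$. Put $$\Omega_m=\frac{W_{2,m}\Gamma_{2,m}-W_{1,m}\Gamma_{1,m}}{\Gamma_{1,m}\Gamma_{2,m}(W_{1,m}-W_{2,m})},$$ and let $\Theta_m>2\Omega_m$ be positive numbers and $P\ge\sum_{m=1}^M\Theta_m$. Consider $$\max_{\boldsymbol q}\ \sum_{m=1}^M f_m^{\mathrm{SR1}\star}(q_m)\quad\text{s.t.}\quad\sum_{m=1}^Mq_m\le P,\ \ q_m\ge\Theta_m\ \forall m,$$ where $$f_m^{\mathrm{SR1}\star}(q_m)=W_{1,m}B_c\log(1+\Omega_m\Gamma_{1,m})+W_{2,m}B_c\log\left(\frac{q_m\Gamma_{2,m}+1}{\Omega_m\Gamma_{2,m}+1}\right).$$ The optimal solution is given by $$q_m^\star=\left[\frac{W_{2,m}B_c}{\lambda}-\frac1{\Gamma_{2,m}}\right]_{\Theta_m}^{\infty},\qquad m=1,\dots,M,$$ where $\lambda>0$ is chosen such that $\sum_{m=1}^Mq_m^\star=P$.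
   Context: Notation: $[x]_a^\infty=\max\{x,a\}$; $\log$ is the base-2 logarithm. Here $q_m$ is the power budget of channel $m$ (two NOMA users per channel, bandwidth $B_c$, channel-to-noise ratios $\Gamma_{l,m}$, weights $W_{l,m}$), and $f_m^{\mathrm{SR1}\star}(q_m)$ is the optimal weighted sum rate on channel $m$ with budget $q_m$. *)

theory Defs
  imports Complex_Main
begin

definition clip_below :: "real \<Rightarrow> real \<Rightarrow> real" where
  "clip_below a x = max x a"

text \<open>User l on channel m has weight W l m and channel-to-noise ratio \<Gamma> l m,
  with l = 1, 2 and m = 1, ..., M; values outside these ranges are never used.\<close>

definition Omega :: "(nat \<Rightarrow> nat \<Rightarrow> real) \<Rightarrow> (nat \<Rightarrow> nat \<Rightarrow> real) \<Rightarrow> nat \<Rightarrow> real" where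
  "Omega W \<Gamma> m =
     (W 2 m * \<Gamma> 2 m - W 1 m * \<Gamma> 1 m) / (\<Gamma> 1 m * \<Gamma> 2 m * (W 1 m - W 2 m))"

definition f_SR1 ::
    "real \<Rightarrow> (nat \<Rightarrow> nat \<Rightarrow> real) \<Rightarrow> (nat \<Rightarrow> nat \<Rightarrow> real) \<Rightarrow> nat \<Rightarrow> real \<Rightarrow> real" where
  "f_SR1 B W \<Gamma> m p =
     W 1 m * B * log 2 (1 + Omega W \<Gamma> m * \<Gamma> 1 m)
     + W 2 m * B * log 2 ((p * \<Gamma> 2 m + 1) / (Omega W \<Gamma> m * \<Gamma> 2 m + 1))"

definition sum_rate ::
    "nat \<Rightarrow> real \<Rightarrow> (nat \<Rightarrow> nat \<Rightarrow> real) \<Rightarrow> (nat \<Rightarrow> nat \<Rightarrow> real) \<Rightarrow> (nat \<Rightarrow> real) \<Rightarrow> real" where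
  "sum_rate M B W \<Gamma> q = (\<Sum>m=1..M. f_SR1 B W \<Gamma> m (q m))"

definition feasible :: "nat \<Rightarrow> real \<Rightarrow> (nat \<Rightarrow> real) \<Rightarrow> (nat \<Rightarrow> real) \<Rightarrow> bool" where
  "feasible M P \<Theta> q \<longleftrightarrow> (\<Sum>m=1..M. q m) \<le> P \<and> (\<forall>m\<in>{1..M}. q m \<ge> \<Theta> m)"

text \<open>The rate uses the base-2 logarithm, but no factor ln 2 appears below: it is absorbed
  into lam, which is only determined by the budget equation.\<close>

definition q_star ::
    "real \<Rightarrow> (nat \<Rightarrow> nat \<Rightarrow> real) \<Rightarrow> (nat \<Rightarrow> nat \<Rightarrow> real) \<Rightarrow> (nat \<Rightarrow> real) \<Rightarrow> real \<Rightarrow> nat \<Rightarrow> real" where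
  "q_star B W \<Gamma> \<Theta> lam m = clip_below (\<Theta> m) (W 2 m * B / lam - 1 / \<Gamma> 2 m)"

end

theory Submission
  imports Defs
begin

text \<open>Water-filling: each rate is strictly concave, so it lies strictly below its tangent at
  the clipped point. There the slope is at most \<open>lam / ln 2\<close>, with equality unless the
  lower bound is active; hence moving from \<open>q_star\<close> to a feasible \<open>q\<close> gains strictly less than
  \<open>lam / ln 2 * (q m - q_star m)\<close> on each channel that changes. Summing and using that
  \<open>q_star\<close> exhausts the budget gives optimality and uniqueness. A multiplier exists by the
  intermediate value theorem applied in the variable \<open>1 / lam\<close>.\<close>

lemma ln_less_minus_one:
  fixes x :: real
  assumes "x > 0" "x \<noteq> 1"
  shows "ln x < x - 1"
  using assms ln_le_minus_one[of x] ln_eq_minus_one[of x] by fastforce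

text \<open>The two ratio bounds make numerator and denominator both negative. Positivity is what
  keeps the argument of the second logarithm in \<open>f_SR1\<close> positive.\<close>

lemma Omega_pos:
  assumes "W 1 m > 0" "\<Gamma> 2 m > 0" "1 < W 2 m / W 1 m" "W 2 m / W 1 m < \<Gamma> 1 m / \<Gamma> 2 m"
  shows "Omega W \<Gamma> m > 0"
proof -
  have w: "W 1 m < W 2 m" using assms by (simp add: less_divide_eq)
  have n: "W 2 m * \<Gamma> 2 m < W 1 m * \<Gamma> 1 m"
    using assms by (simp add: field_simps)
  have "0 < W 1 m * \<Gamma> 1 m" using n w assms by (smt (verit) mult_pos_pos)
  then have "0 < \<Gamma> 1 m" using assms by (simp add: zero_less_mult_iff)
  then have "\<Gamma> 1 m * \<Gamma> 2 m * (W 1 m - W 2 m) < 0"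
    using w assms by (simp add: mult_pos_neg)
  then show ?thesis unfolding Omega_def using n by (simp add: divide_neg_neg)
qed

text \<open>All \<open>Omega\<close> terms cancel in the difference, leaving a multiple of
  \<open>ln r\<close> with \<open>r\<close> the quotient of the two shifted powers. Strict concavity
  then reduces to \<open>ln r < r - 1\<close>.\<close>

lemma f_SR1_less_tangent:
  assumes "W 2 m * B > 0" "\<Gamma> 2 m > 0" "Omega W \<Gamma> m > 0" "p > 0" "x > 0" "p \<noteq> x"
  shows "f_SR1 B W \<Gamma> m p - f_SR1 B W \<Gamma> m x
    < W 2 m * B / (x + 1 / \<Gamma> 2 m) / ln 2 * (p - x)"
proof -
  define r where "r = (p * \<Gamma> 2 m + 1) / (x * \<Gamma> 2 m + 1)"
  have pos: "p * \<Gamma> 2 m + 1 > 0" "x * \<Gamma> 2 m + 1 > 0" "Omega W \<Gamma> m * \<Gamma> 2 m + 1 > 0"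
    using assms by (simp_all add: add_pos_pos)
  have "r > 0" "r \<noteq> 1" using pos assms by (auto simp: r_def)
  then have ln_r: "ln r < r - 1" by (rule ln_less_minus_one)
  \<comment> \<open>Cancelling \<open>\<Gamma> 2 m\<close> exposes the water level
    \<open>x + 1 / \<Gamma> 2 m\<close>, the quantity that \<open>q_star\<close> compares with
    \<open>W 2 m * B / lam\<close>.\<close>
  have r1: "r - 1 = (p - x) / (x + 1 / \<Gamma> 2 m)"
  proof -
    have "r - 1 = (p - x) * \<Gamma> 2 m / (x * \<Gamma> 2 m + 1)"
      using pos by (simp add: r_def field_simps)
    also have "x * \<Gamma> 2 m + 1 = (x + 1 / \<Gamma> 2 m) * \<Gamma> 2 m"
      using assms by (simp add: field_simps)
    finally show ?thesis using assms by simp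
  qed
  have "f_SR1 B W \<Gamma> m p - f_SR1 B W \<Gamma> m x = W 2 m * B / ln 2 * ln r"
    using pos by (simp add: f_SR1_def log_def r_def ln_div field_simps)
  also have "\<dots> < W 2 m * B / ln 2 * (r - 1)"
    using ln_r assms by (intro mult_strict_left_mono) auto
  finally show ?thesis unfolding r1 by (simp add: field_simps)
qed

lemma f_SR1_gain_less:
  assumes "W 2 m * B > 0" "\<Gamma> 2 m > 0" "Omega W \<Gamma> m > 0" "\<Theta> m > 0" "lam > 0"
    and "p \<ge> \<Theta> m" "p \<noteq> q_star B W \<Gamma> \<Theta> lam m"
  shows "f_SR1 B W \<Gamma> m p - f_SR1 B W \<Gamma> m (q_star B W \<Gamma> \<Theta> lam m)
    < lam / ln 2 * (p - q_star B W \<Gamma> \<Theta> lam m)"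
proof -
  define x where "x = q_star B W \<Gamma> \<Theta> lam m"
  define k where "k = W 2 m * B / (x + 1 / \<Gamma> 2 m)"
  have x: "x \<ge> \<Theta> m" "x \<ge> W 2 m * B / lam - 1 / \<Gamma> 2 m"
    by (auto simp: x_def q_star_def clip_below_def)
  have den: "x + 1 / \<Gamma> 2 m > 0" using x assms by (simp add: add_pos_pos)
  have "W 2 m * B / lam \<le> x + 1 / \<Gamma> 2 m" using x by linarith
  then have le: "k \<le> lam" using den assms by (simp add: k_def field_simps)
  \<comment> \<open>Complementary slackness: off the bound the slopes agree, so the sign of
    \<open>p - x\<close> is irrelevant. At the bound, \<open>p - x\<close> is nonnegative and
    \<open>k \<le> lam\<close> suffices.\<close>
  have "k = lam" if "x \<noteq> \<Theta> m"
  proof -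
    have "x + 1 / \<Gamma> 2 m = W 2 m * B / lam"
      using that by (auto simp: x_def q_star_def clip_below_def max_def)
    then show ?thesis using assms(1) by (auto simp: k_def)
  qed
  then have "k * (p - x) \<le> lam * (p - x)"
    using le assms by (cases "x = \<Theta> m") (auto intro: mult_right_mono)
  then have "k / ln 2 * (p - x) \<le> lam / ln 2 * (p - x)"
    by (simp add: divide_right_mono)
  moreover have "f_SR1 B W \<Gamma> m p - f_SR1 B W \<Gamma> m x < k / ln 2 * (p - x)"
    unfolding k_def using assms x by (intro f_SR1_less_tangent) (auto simp: x_def)
  ultimately show ?thesis by (simp add: x_def)
qed

lemma ex_multiplier:
  assumes "M \<ge> 1"
    and WB: "\<And>m. m \<in> {1..M} \<Longrightarrow> W 2 m * B > 0"
    and G: "\<And>m. m \<in> {1..M} \<Longrightarrow> \<Gamma> 2 m > 0"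
    and T: "\<And>m. m \<in> {1..M} \<Longrightarrow> \<Theta> m > 0"
    and P: "P \<ge> (\<Sum>m=1..M. \<Theta> m)"
  shows "\<exists>lam>0. (\<Sum>m=1..M. q_star B W \<Gamma> \<Theta> lam m) = P"
proof -
  define g where "g s = (\<Sum>m=1..M. max (W 2 m * B * s - 1 / \<Gamma> 2 m) (\<Theta> m))" for s
  \<comment> \<open>A sum of positive terms dominates each of them, so at \<open>1 / S\<close> every
    channel is clipped and \<open>g\<close> equals the sum of the lower bounds. The left endpoint is
    positive, which later makes \<open>lam = 1 / s\<close> legitimate.\<close>
  define S where "S = (\<Sum>m=1..M. W 2 m * B / \<Theta> m)"
  have one: "1 \<in> {1..M}" using \<open>M \<ge> 1\<close> by simp
  have S_ge: "W 2 m * B / \<Theta> m \<le> S" if "m \<in> {1..M}" for m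
    unfolding S_def using that WB T by (intro member_le_sum) (auto intro!: less_imp_le)
  have "0 < W 2 1 * B / \<Theta> 1" using WB[OF one] T[OF one] by (simp add: divide_pos_pos)
  then have S: "S > 0" using S_ge[OF one] by linarith
  have low: "g (1 / S) \<le> P"
  proof -
    have "max (W 2 m * B * (1 / S) - 1 / \<Gamma> 2 m) (\<Theta> m) = \<Theta> m" if m: "m \<in> {1..M}" for m
    proof -
      have "W 2 m * B * (1 / S) \<le> \<Theta> m"
        using S_ge[OF m] S T[OF m] by (simp add: field_simps)
      moreover have "1 / \<Gamma> 2 m > 0" using G[OF m] by simp
      ultimately show ?thesis by (intro max_absorb2) linarith
    qed
    then show ?thesis using P by (simp add: g_def)
  qed
  \<comment> \<open>The second argument lets channel 1 alone reach \<open>P\<close>, the other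
    summands being positive; the first keeps the interval nonempty.\<close>
  define s1 where "s1 = max (1 / S) ((P + 1 / \<Gamma> 2 1) / (W 2 1 * B))"
  have high: "P \<le> g s1"
  proof -
    have "(P + 1 / \<Gamma> 2 1) / (W 2 1 * B) \<le> s1" by (simp add: s1_def)
    then have "P \<le> W 2 1 * B * s1 - 1 / \<Gamma> 2 1"
      using WB[OF one] by (simp add: pos_divide_le_eq mult.commute)
    also have "\<dots> \<le> max (W 2 1 * B * s1 - 1 / \<Gamma> 2 1) (\<Theta> 1)" by simp
    also have "\<dots> \<le> g s1" unfolding g_def
      using one T by (intro member_le_sum) (auto intro!: less_imp_le simp: less_max_iff_disj)
    finally show ?thesis .
  qed
  have "continuous_on {1 / S..s1} g"
    unfolding g_def by (intro continuous_intros)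
  then obtain s where s: "1 / S \<le> s" "g s = P"
    using IVT'[of g "1 / S" P s1] low high by (auto simp: s1_def)
  have "s > 0" using s S by (smt (verit) divide_pos_pos)
  moreover have "(\<Sum>m=1..M. q_star B W \<Gamma> \<Theta> (1 / s) m) = P"
    using s by (simp add: q_star_def clip_below_def g_def)
  ultimately show ?thesis by (intro exI[of _ "1 / s"]) simp
qed

theorem theorem2:
  fixes M :: nat and B P :: real
    and W \<Gamma> :: "nat \<Rightarrow> nat \<Rightarrow> real" and \<Theta> :: "nat \<Rightarrow> real"
  assumes "M \<ge> 1" and "B > 0"
    and "\<And>m. m \<in> {1..M} \<Longrightarrow> W 1 m > 0"
    and "\<And>m. m \<in> {1..M} \<Longrightarrow> W 2 m > 0"
    and "\<And>m. m \<in> {1..M} \<Longrightarrow> \<Gamma> 1 m \<ge> \<Gamma> 2 m"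
    and "\<And>m. m \<in> {1..M} \<Longrightarrow> \<Gamma> 2 m > 0"
    and "\<And>m. m \<in> {1..M} \<Longrightarrow> 1 < W 2 m / W 1 m"
    and "\<And>m. m \<in> {1..M} \<Longrightarrow> W 2 m / W 1 m < \<Gamma> 1 m / \<Gamma> 2 m"
    and "\<And>m. m \<in> {1..M} \<Longrightarrow> \<Theta> m > 0"
    and "\<And>m. m \<in> {1..M} \<Longrightarrow> \<Theta> m > 2 * Omega W \<Gamma> m"
    and "P \<ge> (\<Sum>m=1..M. \<Theta> m)"
  shows "(\<exists>lam>0. (\<Sum>m=1..M. q_star B W \<Gamma> \<Theta> lam m) = P) \<and>
    (\<forall>lam>0. (\<Sum>m=1..M. q_star B W \<Gamma> \<Theta> lam m) = P \<longrightarrow>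
      (\<forall>q. is_arg_max (sum_rate M B W \<Gamma>) (feasible M P \<Theta>) q \<longleftrightarrow>
           (\<forall>m\<in>{1..M}. q m = q_star B W \<Gamma> \<Theta> lam m)))"
proof (intro conjI allI impI)
  have WB: "W 2 m * B > 0" if "m \<in> {1..M}" for m
    using assms(2) assms(4)[OF that] by simp
  show "\<exists>lam>0. (\<Sum>m=1..M. q_star B W \<Gamma> \<Theta> lam m) = P"
    by (rule ex_multiplier) (use assms WB in auto)
next
  fix lam q
  assume lam: "lam > 0" and budget: "(\<Sum>m=1..M. q_star B W \<Gamma> \<Theta> lam m) = P"
  define x where "x = q_star B W \<Gamma> \<Theta> lam"
  have gain: "f_SR1 B W \<Gamma> m p - f_SR1 B W \<Gamma> m (x m) < lam / ln 2 * (p - x m)"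
    if m: "m \<in> {1..M}" and "p \<ge> \<Theta> m" "p \<noteq> x m" for m p
    unfolding x_def
    using that assms(2) assms(4,6,9)[OF m] Omega_pos[of W m \<Gamma>, OF assms(3,6,7,8)[OF m]] lam
    by (intro f_SR1_gain_less) (auto simp: x_def)
  have feas: "feasible M P \<Theta> x"
    using budget by (auto simp: feasible_def x_def q_star_def clip_below_def)
  \<comment> \<open>Strictness yields both directions of the equivalence: optimality of
    \<open>x\<close>, and that no maximizer differs from it on a channel.\<close>
  have less: "sum_rate M B W \<Gamma> p < sum_rate M B W \<Gamma> x"
    if p: "feasible M P \<Theta> p" and ne: "\<exists>m\<in>{1..M}. p m \<noteq> x m" for p
  proof -
    have gain_le: "f_SR1 B W \<Gamma> m (p m) - f_SR1 B W \<Gamma> m (x m) \<le> lam / ln 2 * (p m - x m)"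
      if m: "m \<in> {1..M}" for m
      using gain[OF m, of "p m"] p m by (cases "p m = x m") (auto simp: feasible_def)
    have "sum_rate M B W \<Gamma> p - sum_rate M B W \<Gamma> x
        = (\<Sum>m=1..M. f_SR1 B W \<Gamma> m (p m) - f_SR1 B W \<Gamma> m (x m))"
      by (simp add: sum_rate_def sum_subtractf)
    also have "\<dots> < (\<Sum>m=1..M. lam / ln 2 * (p m - x m))"
    proof (rule sum_strict_mono_ex1)
      show "\<exists>m\<in>{1..M}. f_SR1 B W \<Gamma> m (p m) - f_SR1 B W \<Gamma> m (x m)
          < lam / ln 2 * (p m - x m)"
        using ne gain p unfolding feasible_def by blast
    qed (use gain_le in auto)
    \<comment> \<open>The multiplier is common to all channels, so only total power remains, and
      \<open>x\<close> spends exactly \<open>P\<close>.\<close>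
    also have "\<dots> = lam / ln 2 * ((\<Sum>m=1..M. p m) - P)"
      using budget by (simp only: sum_distrib_left[symmetric] sum_subtractf x_def)
    also have "\<dots> \<le> 0"
      using p lam by (intro mult_nonneg_nonpos) (auto simp: feasible_def)
    finally show ?thesis by simp
  qed
  show "is_arg_max (sum_rate M B W \<Gamma>) (feasible M P \<Theta>) q \<longleftrightarrow>
      (\<forall>m\<in>{1..M}. q m = q_star B W \<Gamma> \<Theta> lam m)"
  proof
    assume "is_arg_max (sum_rate M B W \<Gamma>) (feasible M P \<Theta>) q"
    then show "\<forall>m\<in>{1..M}. q m = q_star B W \<Gamma> \<Theta> lam m"
      using less[of q] feas by (auto simp: is_arg_max_def x_def)
  next
    assume "\<forall>m\<in>{1..M}. q m = q_star B W \<Gamma> \<Theta> lam m"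
    then have eq: "\<forall>m\<in>{1..M}. q m = x m" by (simp add: x_def)
    \<comment> \<open>As functions, \<open>q\<close> and \<open>x\<close> may differ outside
      \<open>{1..M}\<close>, so values are compared rather than the functions identified.\<close>
    have same: "sum_rate M B W \<Gamma> r = sum_rate M B W \<Gamma> x" if "\<forall>m\<in>{1..M}. r m = x m" for r
      using that by (simp add: sum_rate_def)
    have "feasible M P \<Theta> q" using feas eq by (simp add: feasible_def)
    moreover have "sum_rate M B W \<Gamma> p \<le> sum_rate M B W \<Gamma> q" if "feasible M P \<Theta> p" for p
      using same[OF eq] same[of p] less[OF that] by fastforce
    ultimately show "is_arg_max (sum_rate M B W \<Gamma>) (feasible M P \<Theta>) q"
      by (auto simp: is_arg_max_def not_less)
  qed
qed

end
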